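(* Let $p\in[0,1)$, $a=2p-1\in[-1,1)$, and let $(S_n)_{n\ge1}$ be the elephant random walk with memory parameter $p$ and first step parameter $q=1$ (so that $S_n$ takes values in $\{2k-n:\ k=1,\dots,n\}$). The finite sequence $\{\mathbb P[S_n=2k-n],\ k=1,\dots,n\}$ is log-concave for every $n\ge1$ if and only if $a\in[-1,a_0]$, where $a_0=0.61803\ldots$ is the unique positive root of the equation $a^3+4a^2+2a=3$.
   Context: Elephant random walk (ERW) with memory parameter $p$ and first step parameter $q=1$: $S_0=0$, $S_1=X_1=+1$; for $n\ge 1$, $X_{n+1}=+X_{\mathcal U(n)}$ with probability $p$ and $X_{n+1}=-X_{\mathcal U(n)}$ with probability $1-p$, where $\mathcal U(n)$ is uniform on $\{1,\dots,n\}$ and all choices are independent of each other and of the past; $S_{n+1}=S_n+X_{n+1}$. A finite sequence $\{u_k,\ k=1,\dots,n\}$ of nonnegative numbers is log-concave if $u_k^2\ge u_{k-1}u_{k+1}$ for all $k=1,\dots,n$, with the convention $u_0=u_{n+1}=0$. *)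

theory Defs
  imports "HOL-Probability.Probability"
begin

text \<open>
  The index \<open>n \<ge> 1\<close> of \<open>U\<close> and \<open>K\<close> refers to the choices made at time \<open>n\<close>, which determine
  \<open>X\<^sub>n\<^sub>+\<^sub>1\<close>: \<open>U n\<close> is the remembered time and \<open>K n\<close> tells whether the remembered step is
  repeated (\<open>True\<close>) or reversed (\<open>False\<close>). The product law in \<open>choice_law\<close> makes \<open>U n\<close> and
  \<open>K n\<close> independent of each other; with \<open>choices_indep\<close>, the whole family of choices is
  independent. Since \<open>X\<^sub>1\<close> is constant, the past at time \<open>n\<close> is a function of the choices made
  at times below \<open>n\<close>, so independence of the past is included.
  The requirement that \<open>U n\<close> lies in \<open>{1..n}\<close> everywhere, and not just almost
  surely, makes the recursion for \<open>X\<close> well-founded at every point, so that each \<open>X n\<close> is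
  measurable.
\<close>

locale elephant_random_walk = prob_space M
  for M :: "'a measure"
    and p :: real
    and U :: "nat \<Rightarrow> 'a \<Rightarrow> nat"
    and K :: "nat \<Rightarrow> 'a \<Rightarrow> bool"
    and X :: "nat \<Rightarrow> 'a \<Rightarrow> int" +
  assumes p_range: "0 \<le> p" "p \<le> 1"
    and U_range: "\<And>n \<omega>. n \<ge> 1 \<Longrightarrow> \<omega> \<in> space M \<Longrightarrow> U n \<omega> \<in> {1..n}"
    and choices_indep:
      "indep_vars (\<lambda>_. count_space UNIV) (\<lambda>n \<omega>. (U n \<omega>, K n \<omega>)) {1..}"
    and choice_law:
      "\<And>n. n \<ge> 1 \<Longrightarrow> distr M (count_space UNIV) (\<lambda>\<omega>. (U n \<omega>, K n \<omega>)) =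
         measure_pmf (pair_pmf (pmf_of_set {1..n}) (bernoulli_pmf p))"
    and first_step: "\<And>\<omega>. \<omega> \<in> space M \<Longrightarrow> X 1 \<omega> = 1"
    and next_step:
      "\<And>n \<omega>. n \<ge> 1 \<Longrightarrow> \<omega> \<in> space M \<Longrightarrow>
         X (n + 1) \<omega> = (if K n \<omega> then X (U n \<omega>) \<omega> else - X (U n \<omega>) \<omega>)"

definition walk_position :: "(nat \<Rightarrow> 'a \<Rightarrow> int) \<Rightarrow> nat \<Rightarrow> 'a \<Rightarrow> int" where
  "walk_position X n \<omega> = (\<Sum>i=1..n. X i \<omega>)"

text \<open>The convention \<open>u\<^sub>0 = u\<^sub>n\<^sub>+\<^sub>1 = 0\<close> is imposed by the definition;
  values of \<open>u\<close> outside \<open>{1..n}\<close> are ignored.\<close>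

definition log_concave_seq :: "nat \<Rightarrow> (nat \<Rightarrow> real) \<Rightarrow> bool" where
  "log_concave_seq n u \<longleftrightarrow>
     (let v = (\<lambda>k. if k \<in> {1..n} then u k else 0)
      in (\<forall>k\<in>{1..n}. u k \<ge> 0) \<and> (\<forall>k\<in>{1..n}. (v k)\<^sup>2 \<ge> v (k - 1) * v (k + 1)))"

end

theory Submission
  imports Defs
begin

text \<open>
  The number of positive steps among the first \<open>n\<close> determines \<open>S\<^sub>n\<close>, and its law \<open>u n\<close> satisfies a
  two-term recursion whose weights are linear in \<open>k\<close> with opposite slopes \<open>-2a\<close> and \<open>2a\<close>. As long
  as the weights involved are nonnegative, such a recursion preserves log-concavity: what is left of
  \<open>u\<^sub>k\<^sup>2 - u\<^sub>k\<^sub>-\<^sub>1 u\<^sub>k\<^sub>+\<^sub>1\<close> is a multiple of a square. A weight just outside the support is negative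
  when \<open>a > n / (n + 2)\<close>, so the small cases \<open>n \<le> 4\<close> are checked by hand; from \<open>n = 4\<close> on the
  condition \<open>a \<le> 2/3\<close> suffices. For \<open>n = 3\<close> log-concavity amounts to
  \<open>a\<^sup>3 + 4 a\<^sup>2 + 2 a - 3 = (a + 3) (a\<^sup>2 + a - 1) \<le> 0\<close>, which is where \<open>a\<^sub>0\<close> comes from.
\<close>

text \<open>After inserting the three hypotheses on the \<open>x\<close>'s, the difference of the two sides is
  \<open>d\<^sup>2 * (x2 - x1)\<^sup>2\<close>.\<close>

lemma linear_weights_log_concave:
  fixes A B d :: real
  assumes x: "x0 * x2 \<le> x1\<^sup>2" "x1 * x3 \<le> x2\<^sup>2" "x0 * x3 \<le> x1 * x2"
    and weights: "A + d \<ge> 0" "A - d \<ge> 0" "B + d \<ge> 0" "B - d \<ge> 0"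
  shows "((A + d) * x1 + (B - d) * x0) * ((A - d) * x3 + (B + d) * x2) \<le> (A * x2 + B * x1)\<^sup>2"
proof -
  have "((A + d) * (A - d)) * (x1 * x3) \<le> ((A + d) * (A - d)) * x2\<^sup>2"
    "((B + d) * (B - d)) * (x0 * x2) \<le> ((B + d) * (B - d)) * x1\<^sup>2"
    "((A - d) * (B - d)) * (x0 * x3) \<le> ((A - d) * (B - d)) * (x1 * x2)"
    using x weights by (intro mult_left_mono; simp)+
  moreover have "0 \<le> (d * (x2 - x1))\<^sup>2" by simp
  ultimately show ?thesis by (simp add: algebra_simps power2_eq_square)
qed

section \<open>Arrays satisfying the two-term recursion\<close>

text \<open>Separates the analysis from the probability: \<open>u n k\<close> stands for the
  probability that exactly \<open>k\<close> of the first \<open>n\<close> steps are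
  \<open>+1\<close>. Given \<open>k\<close> such steps, the next one is \<open>+1\<close> with
  probability \<open>(n * (1 - a) + 2 * a * k) / (2 * n)\<close>, which is where the weights come
  from.\<close>

locale erw_array =
  fixes a :: real and u :: "nat \<Rightarrow> nat \<Rightarrow> real"
  assumes a_range: "-1 \<le> a" "a < 1"
    and u_one: "u 1 k = of_bool (k = 1)"
    and u_zero: "n \<ge> 1 \<Longrightarrow> u n 0 = 0"
    and u_Suc: "n \<ge> 1 \<Longrightarrow> 2 * real n * u (Suc n) (Suc k) =
      (n * (1 + a) - 2 * a * Suc k) * u n (Suc k) + (n * (1 - a) + 2 * a * k) * u n k"
begin

lemma u_above: "n \<ge> 1 \<Longrightarrow> k > n \<Longrightarrow> u n k = 0"
proof (induction n arbitrary: k rule: nat_induct_at_least)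
  case base
  then show ?case by (simp only: u_one) simp
next
  case (Suc n)
  then obtain j where "k = Suc j" by (cases k) auto
  then show ?case using Suc u_Suc[of n j] by simp
qed

text \<open>Up to the factor \<open>2 * n\<close> this weight and the next one are conditional
  probabilities of a step \<open>-1\<close> and \<open>+1\<close>, so they are nonnegative for
  \<open>k \<le> n\<close>. Beyond that range the sign is not guaranteed.\<close>

lemma minus_weight_nonneg:
  assumes "k \<le> n" shows "real n * (1 + a) - 2 * a * k \<ge> 0"
proof -
  have "real n * (1 + a) - 2 * a * k = (real n - k) * (1 + a) + k * (1 - a)"
    by (simp add: algebra_simps)
  then show ?thesis using assms a_range by simp
qed

lemma plus_weight_nonneg:
  assumes "k \<le> n" shows "real n * (1 - a) + 2 * a * k \<ge> 0"
proof -
  have "real n * (1 - a) + 2 * a * k = (real n - k) * (1 - a) + k * (1 + a)"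
    by (simp add: algebra_simps)
  then show ?thesis using assms a_range by simp
qed

lemma u_nonneg: "n \<ge> 1 \<Longrightarrow> u n k \<ge> 0"
proof (induction n arbitrary: k rule: nat_induct_at_least)
  case base
  then show ?case by (simp only: u_one) simp
next
  case (Suc n)
  show ?case
  proof (cases "k = 0 \<or> k > Suc n")
    case True
    then show ?thesis using u_zero u_above by auto
  next
    case False
    then obtain j where j: "k = Suc j" "j \<le> n" by (cases k) auto
    \<comment> \<open>For \<open>j = n\<close> the weight may be negative, but then
      \<open>u n (Suc j)\<close> vanishes.\<close>
    have "(n * (1 + a) - 2 * a * Suc j) * u n (Suc j) \<ge> 0"
      using minus_weight_nonneg[of "Suc j" n] Suc u_above[of n "Suc j"]
      by (cases "Suc j \<le> n") auto
    moreover have "(n * (1 - a) + 2 * a * j) * u n j \<ge> 0"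
      using plus_weight_nonneg[OF j(2)] Suc by simp
    ultimately have "2 * real n * u (Suc n) (Suc j) \<ge> 0"
      using u_Suc[of n j] Suc by simp
    then show ?thesis using j Suc by (simp add: zero_le_mult_iff)
  qed
qed

text \<open>The right end \<open>u n n\<close> is excluded because it vanishes when \<open>a = -1\<close>.\<close>

lemma u_pos: "1 \<le> k \<Longrightarrow> k < n \<Longrightarrow> u n k > 0"
proof (induction n arbitrary: k)
  case 0
  then show ?case by simp
next
  case (Suc n)
  from Suc.prems obtain j where j: "k = Suc j" "Suc j \<le> n" by (cases k) auto
  have n: "n \<ge> 1" using j by simp
  have nonneg: "(n * (1 + a) - 2 * a * Suc j) * u n (Suc j) \<ge> 0"
      "(n * (1 - a) + 2 * a * j) * u n j \<ge> 0"
    using minus_weight_nonneg[OF j(2)] plus_weight_nonneg[of j n] j u_nonneg[OF n] by auto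
  \<comment> \<open>Both summands are nonnegative, so one strictly positive summand is enough. At
    \<open>Suc j = n > 1\<close> it has to be the second, since \<open>u n n\<close> may vanish;
    otherwise it is the first.\<close>
  have "0 < (n * (1 + a) - 2 * a * Suc j) * u n (Suc j) + (n * (1 - a) + 2 * a * j) * u n j"
  proof (cases "Suc j = n")
    case True
    show ?thesis
    proof (cases "j = 0")
      case True
      with \<open>Suc j = n\<close> have "n = 1" by simp
      then show ?thesis using True u_one[of 1] u_zero[of 1] a_range by simp
    next
      case False
      have "n * (1 - a) + 2 * a * j = j * (1 + a) + (1 - a)"
        using True by (auto simp: algebra_simps)
      then have "n * (1 - a) + 2 * a * j > 0"
        using a_range by (simp add: add_nonneg_pos)
      moreover have "u n j > 0" using Suc.IH False True by simp
      ultimately show ?thesis using nonneg by (simp add: add_nonneg_pos)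
    qed
  next
    case False
    have "n * (1 + a) - 2 * a * Suc j = (real n - Suc j) * (1 + a) + Suc j * (1 - a)"
      by (simp add: algebra_simps)
    moreover have "(real n - Suc j) * (1 + a) \<ge> 0" using j a_range by simp
    moreover have "Suc j * (1 - a) > 0" using a_range by simp
    ultimately have "n * (1 + a) - 2 * a * Suc j > 0" by linarith
    moreover have "u n (Suc j) > 0" using Suc.IH False j by simp
    ultimately show ?thesis using nonneg by (simp add: add_pos_nonneg)
  qed
  then have "2 * real n * u (Suc n) (Suc j) > 0" using u_Suc[OF n, of j] by simp
  then show ?case using j n by (simp add: zero_less_mult_iff)
qed

text \<open>The recursion already makes \<open>u n\<close> vanish outside \<open>{1..n}\<close>, so
  the boundary convention changes nothing and the inequality may be asked at every index. The shift
  to \<open>Suc\<close> avoids subtraction on the naturals.\<close>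

lemma log_concave_seq_iff:
  assumes "n \<ge> 1"
  shows "log_concave_seq n (u n) \<longleftrightarrow> (\<forall>k. u n k * u n (Suc (Suc k)) \<le> (u n (Suc k))\<^sup>2)"
proof -
  have v: "(\<lambda>k. if k \<in> {1..n} then u n k else 0) = u n"
    using u_zero[OF assms] u_above[OF assms] by (auto simp: not_le)
  have "(\<forall>k\<in>{1..n}. u n (k - 1) * u n (k + 1) \<le> (u n k)\<^sup>2) \<longleftrightarrow>
     (\<forall>k. u n k * u n (Suc (Suc k)) \<le> (u n (Suc k))\<^sup>2)" (is "?L \<longleftrightarrow> ?R")
  proof
    assume L: ?L
    show ?R
    proof
      fix k
      show "u n k * u n (Suc (Suc k)) \<le> (u n (Suc k))\<^sup>2"
        using bspec[OF L, of "Suc k"] u_above[OF assms, of "Suc (Suc k)"]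
        by (cases "Suc k \<le> n") auto
    qed
  next
    assume R: ?R
    show ?L
    proof
      fix k assume "k \<in> {1..n}"
      then show "u n (k - 1) * u n (k + 1) \<le> (u n k)\<^sup>2" using R by (cases k) auto
    qed
  qed
  then show ?thesis
    unfolding log_concave_seq_def Let_def v using u_nonneg[OF assms] by simp
qed

section \<open>Explicit values and log-concavity for n up to 4\<close>

lemma u_two: "u 2 1 = (1 - a) / 2" "u 2 2 = (1 + a) / 2"
  using u_Suc[of 1 0] u_Suc[of 1 1] u_one[of 0] u_one[of 1] u_one[of 2]
  by (simp_all add: numeral_eq_Suc)

lemma u_three: "u 3 1 = (1 - a) / 4" "u 3 2 = (1 - a) * (2 + a) / 4" "u 3 3 = (1 + a)\<^sup>2 / 4"
  using u_Suc[of 2 0] u_Suc[of 2 1] u_Suc[of 2 2] u_two u_zero[of 2] u_above[of 2 3]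
  by (simp_all add: eval_nat_numeral field_simps)


lemma u_four:
  "u 4 1 = (1 - a) * (3 + a) / 24" "u 4 2 = (1 - a) * (9 - a\<^sup>2) / 24"
  "u 4 3 = (1 - a) * (9 + 11 * a + 4 * a\<^sup>2) / 24" "u 4 4 = (1 + a) ^ 3 / 8"
proof -
  note three = u_three u_zero[of 3] u_above[of 3 4]
  have "6 * u 4 1 = (3 + a) * u 3 1"
    using u_Suc[of 3 0] three(4) by (simp add: algebra_simps)
  then show "u 4 1 = (1 - a) * (3 + a) / 24" unfolding three by (simp add: field_simps)
  have "6 * u 4 2 = (3 - a) * u 3 2 + (3 - a) * u 3 1"
    using u_Suc[of 3 1] by (simp add: algebra_simps numeral_2_eq_2[symmetric])
  then show "u 4 2 = (1 - a) * (9 - a\<^sup>2) / 24"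
    unfolding three by (simp add: field_simps power2_eq_square)
  have "6 * u 4 3 = 3 * (1 - a) * u 3 3 + (3 + a) * u 3 2"
    using u_Suc[of 3 2] by (simp add: algebra_simps)
  then show "u 4 3 = (1 - a) * (9 + 11 * a + 4 * a\<^sup>2) / 24"
    unfolding three by (simp add: field_simps power2_eq_square)
  have "6 * u 4 4 = 3 * (1 + a) * u 3 3"
    using u_Suc[of 3 3] three(5) by (simp add: algebra_simps)
  then show "u 4 4 = (1 + a) ^ 3 / 8"
    unfolding three by (simp add: field_simps power2_eq_square power3_eq_cube)
qed

lemma log_concave_one: "log_concave_seq 1 (u 1)"
  using u_above[of 1] by (subst log_concave_seq_iff) auto

lemma log_concave_two: "log_concave_seq 2 (u 2)"
proof -
  have "u 2 k * u 2 (Suc (Suc k)) = 0" for k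
    using u_zero[of 2] u_above[of 2 "Suc (Suc k)"] by (cases k) auto
  then have "u 2 k * u 2 (Suc (Suc k)) \<le> (u 2 (Suc k))\<^sup>2" for k
    by (simp only: zero_le_power2)
  then show ?thesis by (subst log_concave_seq_iff) auto
qed

lemma log_concave_three: "log_concave_seq 3 (u 3) \<longleftrightarrow> a\<^sup>2 + a \<le> 1"
proof -
  have "(\<forall>k. u 3 k * u 3 (Suc (Suc k)) \<le> (u 3 (Suc k))\<^sup>2) \<longleftrightarrow> u 3 1 * u 3 3 \<le> (u 3 2)\<^sup>2"
    (is "?L \<longleftrightarrow> ?R")
  proof
    assume ?L
    from spec[OF this, of 1] show ?R by (simp add: eval_nat_numeral)
  next
    assume R: ?R
    show ?L
    proof
      fix k :: nat
      consider "k = 0" | "k = 1" | "k \<ge> 2" by linarith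
      then show "u 3 k * u 3 (Suc (Suc k)) \<le> (u 3 (Suc k))\<^sup>2"
        using R u_zero[of 3] u_above[of 3 "Suc (Suc k)"]
        by cases (auto simp: eval_nat_numeral)
    qed
  qed
  also have "\<dots> \<longleftrightarrow> 0 \<le> 16 * ((u 3 2)\<^sup>2 - u 3 1 * u 3 3)" by simp
  \<comment> \<open>The first two factors are positive because \<open>-1 \<le> a < 1\<close>, so the
    last one decides the sign.\<close>
  also have "16 * ((u 3 2)\<^sup>2 - u 3 1 * u 3 3) = (1 - a) * (3 + a) * (1 - (a\<^sup>2 + a))"
    unfolding u_three by (simp add: field_simps power2_eq_square)
  also have "0 \<le> \<dots> \<longleftrightarrow> a\<^sup>2 + a \<le> 1"
  proof -
    have "(1 - a) * (3 + a) > 0" using a_range by simp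
    from mult_le_cancel_left_pos[OF this, of 0 "1 - (a\<^sup>2 + a)"] show ?thesis
      by (simp only: mult_zero_right diff_ge_0_iff_ge)
  qed
  finally show ?thesis by (subst log_concave_seq_iff) auto
qed

lemma log_concave_four:
  assumes "a\<^sup>2 + a \<le> 1"
  shows "log_concave_seq 4 (u 4)"
proof -
  \<comment> \<open>After \<open>(1 - a)^2\<close> is taken out, the quartic
    \<open>54 - 42 a - 41 a^2 - 4 a^3 + a^4\<close> remains; it is regrouped into terms that are
    nonnegative under the hypothesis.\<close>
  have "0 \<le> (1 - a)\<^sup>2 * (41 * (1 - (a\<^sup>2 + a)) + 8 + (1 - a) + 4 * (1 - a ^ 3) + a ^ 4)"
  proof -
    have "a ^ 3 \<le> 1"
      using a_range power_le_one[of a 3] by (cases "a \<ge> 0")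
        (auto simp: power_le_zero_eq intro: order_trans[of _ 0])
    then show ?thesis using assms a_range by (intro mult_nonneg_nonneg add_nonneg_nonneg) auto
  qed
  also have "\<dots> = 24\<^sup>2 * ((u 4 2)\<^sup>2 - u 4 1 * u 4 3)"
    unfolding u_four by (simp add: field_simps power2_eq_square power3_eq_cube power4_eq_xxxx)
  finally have two: "u 4 1 * u 4 3 \<le> (u 4 2)\<^sup>2" by simp
  \<comment> \<open>After \<open>1 - a\<close> is taken out, a quintic remains, written as a
    nonnegative multiple of \<open>1 - (a^2 + a)\<close> plus a positive quadratic. The factor with
    the odd constants is \<open>13 a^2 + 37 a + 49\<close> with the square completed.\<close>
  have "0 \<le> (1 - a) * ((1 - (a\<^sup>2 + a)) * ((a + 1) * (13 * (a + 37 / 26)\<^sup>2 + 1179 / 52))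
        + (5 - a + 2 * a\<^sup>2))"
    using assms a_range
    by (intro mult_nonneg_nonneg add_nonneg_nonneg[of "_ * _"] add_nonneg_nonneg[of "5 - a"]) auto
  also have "\<dots> = 24\<^sup>2 * ((u 4 3)\<^sup>2 - u 4 2 * u 4 4)"
    unfolding u_four by (simp add: field_simps power2_eq_square power3_eq_cube)
  finally have three: "u 4 2 * u 4 4 \<le> (u 4 3)\<^sup>2" by simp
  have "u 4 k * u 4 (Suc (Suc k)) \<le> (u 4 (Suc k))\<^sup>2" for k
  proof -
    consider "k = 0" | "k = 1" | "k = 2" | "k \<ge> 3" by linarith
    then show ?thesis
      using two three u_zero[of 4] u_above[of 4 "Suc (Suc k)"]
      by cases (auto simp: eval_nat_numeral)
  qed
  then show ?thesis by (subst log_concave_seq_iff) auto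
qed

section \<open>Propagation of log-concavity\<close>

text \<open>Three consecutive entries of row \<open>Suc n\<close> come from four consecutive entries
  of row \<open>n\<close>, with weights in arithmetic progression. This is the setting of
  \<open>linear_weights_log_concave\<close> with \<open>d = 2 * a\<close>, where \<open>a\<close>
  may have either sign.\<close>

lemma log_concave_Suc:
  assumes n: "n \<ge> 4" and a: "a \<le> 2 / 3" and lc: "log_concave_seq n (u n)"
  shows "log_concave_seq (Suc n) (u (Suc n))"
proof -
  have lc': "u n k * u n (Suc (Suc k)) \<le> (u n (Suc k))\<^sup>2" for k
    using lc n by (subst (asm) log_concave_seq_iff) auto
  have "u (Suc n) j * u (Suc n) (Suc (Suc j)) \<le> (u (Suc n) (Suc j))\<^sup>2" for j
  proof (cases "j = 0 \<or> Suc j > n")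
    case True
    then show ?thesis
      using u_zero[of "Suc n"] u_above[of "Suc n" "Suc (Suc j)"] n by auto
  next
    case False
    then obtain i where i: "j = Suc i" "Suc (Suc i) \<le> n" by (cases j) auto
    define A where "A = n * (1 + a) - 2 * a * Suc (Suc i)"
    define B where "B = n * (1 - a) + 2 * a * Suc i"
    let ?x = "\<lambda>m. u n (i + m)"
    have eqs: "2 * real n * u (Suc n) j = (A + 2 * a) * ?x 1 + (B - 2 * a) * ?x 0"
      "2 * real n * u (Suc n) (Suc j) = A * ?x 2 + B * ?x 1"
      "2 * real n * u (Suc n) (Suc (Suc j)) = (A - 2 * a) * ?x 3 + (B + 2 * a) * ?x 2"
      using u_Suc[of n i] u_Suc[of n "Suc i"] u_Suc[of n "Suc (Suc i)"] n
      by (simp_all add: i A_def B_def algebra_simps eval_nat_numeral)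
    have "A + 2 * a \<ge> 0" "B - 2 * a \<ge> 0" "B + 2 * a \<ge> 0"
      using minus_weight_nonneg[of "Suc i" n] plus_weight_nonneg[of i n]
        plus_weight_nonneg[of "Suc (Suc i)" n] i
      by (simp_all add: A_def B_def algebra_simps)
    moreover have "A - 2 * a \<ge> 0"
    proof (cases "i + 3 \<le> n")
      case True
      then show ?thesis using minus_weight_nonneg[of "i + 3" n]
        by (simp add: A_def algebra_simps)
    next
      case False
      then have "n = i + 2" using i by simp
      \<comment> \<open>Here the weight belongs to index \<open>n + 1\<close>, outside the support.
        Its lower bound \<open>4 * (1 - a) - 2 * a = 4 - 6 * a\<close> explains both
        \<open>n \<ge> 4\<close> and \<open>a \<le> 2 / 3\<close>.\<close>
      then have "A - 2 * a = real n * (1 - a) - 2 * a" by (simp add: A_def algebra_simps)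
      moreover have "real n * (1 - a) \<ge> 4 * (1 - a)"
        using n a by (intro mult_right_mono) auto
      ultimately show ?thesis using a by simp
    qed
    \<comment> \<open>In the interior, multiply two neighbouring log-concavity inequalities and
      cancel the positive product \<open>?x 1 * ?x 2\<close>. At the ends the left side is
      zero.\<close>
    moreover have "?x 0 * ?x 3 \<le> ?x 1 * ?x 2"
    proof (cases "i = 0 \<or> i + 3 > n")
      case True
      then show ?thesis using u_zero[of n] u_above[of n "i + 3"] u_nonneg[of n] n by auto
    next
      case False
      then have pos: "?x 1 > 0" "?x 2 > 0" by (auto intro!: u_pos)
      have "(?x 0 * ?x 2) * (?x 1 * ?x 3) \<le> (?x 1)\<^sup>2 * (?x 2)\<^sup>2"
        using lc'[of i] lc'[of "i + 1"] u_nonneg[of n] n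
        by (intro mult_mono) (auto simp: eval_nat_numeral)
      then have "(?x 0 * ?x 3) * (?x 1 * ?x 2) \<le> (?x 1 * ?x 2) * (?x 1 * ?x 2)"
        by (simp add: power2_eq_square mult_ac)
      then show ?thesis using pos by (simp add: mult_le_cancel_right)
    qed
    ultimately have "((A + 2 * a) * ?x 1 + (B - 2 * a) * ?x 0) *
        ((A - 2 * a) * ?x 3 + (B + 2 * a) * ?x 2) \<le> (A * ?x 2 + B * ?x 1)\<^sup>2"
      using lc'[of i] lc'[of "i + 1"]
      by (intro linear_weights_log_concave) (auto simp: eval_nat_numeral)
    then have "(2 * real n)\<^sup>2 * (u (Suc n) j * u (Suc n) (Suc (Suc j)))
        \<le> (2 * real n)\<^sup>2 * (u (Suc n) (Suc j))\<^sup>2"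
      unfolding eqs[symmetric] by (simp add: power_mult_distrib power2_eq_square mult_ac)
    then show ?thesis using n by (simp add: mult_le_cancel_left)
  qed
  then show ?thesis by (subst log_concave_seq_iff) auto
qed

lemma log_concave_all_iff: "(\<forall>n\<ge>1. log_concave_seq n (u n)) \<longleftrightarrow> a\<^sup>2 + a \<le> 1"
proof
  assume "\<forall>n\<ge>1. log_concave_seq n (u n)"
  then show "a\<^sup>2 + a \<le> 1" using log_concave_three by simp
next
  assume a: "a\<^sup>2 + a \<le> 1"
  \<comment> \<open>At \<open>a = 2/3\<close> the sum \<open>a^2 + a\<close> is \<open>10/9\<close>,
    already above 1.\<close>
  have a': "a \<le> 2 / 3"
  proof (rule ccontr)
    assume "\<not> a \<le> 2 / 3"
    then have "(2 / 3)\<^sup>2 < a\<^sup>2" by (intro power_strict_mono) auto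
    then show False using a \<open>\<not> a \<le> 2 / 3\<close> by (simp add: power2_eq_square)
  qed
  show "\<forall>n\<ge>1. log_concave_seq n (u n)"
  proof (intro allI impI)
    fix n :: nat assume "n \<ge> 1"
    then consider "n = 1" | "n = 2" | "n = 3" | "n \<ge> 4" by linarith
    then show "log_concave_seq n (u n)"
    proof cases
      case 4
      then show ?thesis
        by (induction n rule: nat_induct_at_least)
          (auto intro: log_concave_four log_concave_Suc a a')
    qed (use log_concave_one log_concave_two log_concave_three a in auto)
  qed
qed

end

section \<open>Independence of the past and the current choice\<close>

context elephant_random_walk
begin

text \<open>\<open>U m\<close> never exceeds \<open>m\<close>, so unfolding the recursion leads back
  to the constant first step. The choice at time \<open>m\<close> produces step
  \<open>m + 1\<close>, hence choices strictly before \<open>n\<close> determine the steps up to and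
  including \<open>n\<close>.\<close>

lemma X_eq_if_choices_eq:
  assumes "\<omega> \<in> space M" "\<omega>' \<in> space M"
    and "\<And>i. i \<in> {1..<n} \<Longrightarrow> U i \<omega> = U i \<omega>' \<and> K i \<omega> = K i \<omega>'"
    and "j \<in> {1..n}"
  shows "X j \<omega> = X j \<omega>'"
  using assms(4)
proof (induction j rule: less_induct)
  case (less j)
  show ?case
  proof (cases "j = 1")
    case True
    then show ?thesis using first_step assms by simp
  next
    case False
    then obtain m where m: "j = m + 1" "m \<ge> 1" "m \<in> {1..<n}"
      using less.prems by (cases j) auto
    then have "X (U m \<omega>) \<omega> = X (U m \<omega>) \<omega>'"
      using U_range[OF m(2) assms(1)] less by auto
    then show ?thesis using m next_step assms by simp
  qed
qed

lemma X_values: "\<omega> \<in> space M \<Longrightarrow> j \<ge> 1 \<Longrightarrow> X j \<omega> = 1 \<or> X j \<omega> = -1"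
proof (induction j rule: less_induct)
  case (less j)
  show ?case
  proof (cases "j = 1")
    case True
    then show ?thesis using first_step less by simp
  next
    case False
    then obtain m where m: "j = m + 1" "m \<ge> 1" using less.prems by (cases j) auto
    then have "U m \<omega> < j" "U m \<omega> \<ge> 1" using U_range[OF m(2) less.prems(1)] by auto
    then have "X (U m \<omega>) \<omega> = 1 \<or> X (U m \<omega>) \<omega> = -1" using less by blast
    then show ?thesis using m next_step[OF m(2) less.prems(1)] by auto
  qed
qed

text \<open>Such a \<open>Q\<close> is automatically measurable, since the choices before time \<open>n\<close> have only countably
  many outcomes.\<close>

definition past_event :: "nat \<Rightarrow> ('a \<Rightarrow> bool) \<Rightarrow> bool" where
  "past_event n Q \<longleftrightarrow> (\<forall>\<omega>\<in>space M. \<forall>\<omega>'\<in>space M.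
     (\<forall>i\<in>{1..<n}. U i \<omega> = U i \<omega>' \<and> K i \<omega> = K i \<omega>') \<longrightarrow> Q \<omega> = Q \<omega>')"

lemma past_event_X:
  assumes "\<And>\<omega> \<omega>'. \<omega> \<in> space M \<Longrightarrow> \<omega>' \<in> space M \<Longrightarrow> (\<And>j. j \<in> {1..n} \<Longrightarrow> X j \<omega> = X j \<omega>') \<Longrightarrow> Q \<omega> = Q \<omega>'"
  shows "past_event n Q"
  unfolding past_event_def using assms X_eq_if_choices_eq by blast

text \<open>The choices split into the disjoint blocks \<open>{1..<n}\<close> and
  \<open>{n}\<close>, which are independent as random vectors. Each block takes countably many
  values, so every set of values is measurable.\<close>

lemma past_event_indep:
  assumes n: "n \<ge> 1" and Q: "past_event n Q"
  shows "{\<omega>\<in>space M. Q \<omega>} \<in> events"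
    and "{\<omega>\<in>space M. (U n \<omega>, K n \<omega>) = d} \<in> events"
    and "\<P>(\<omega> in M. Q \<omega> \<and> (U n \<omega>, K n \<omega>) = d) = \<P>(\<omega> in M. Q \<omega>) * \<P>(\<omega> in M. (U n \<omega>, K n \<omega>) = d)"
proof -
  let ?C = "\<lambda>i \<omega>. (U i \<omega>, K i \<omega>)"
  let ?P = "\<lambda>I. PiM I (\<lambda>_. count_space UNIV) :: (nat \<Rightarrow> nat \<times> bool) measure"
  let ?past = "\<lambda>\<omega>. \<lambda>i\<in>{1..<n}. ?C i \<omega>"
  let ?now = "\<lambda>\<omega>. \<lambda>i\<in>{n}. ?C i \<omega>"
  define E where "E = ?past ` {\<omega>\<in>space M. Q \<omega>}"
  define D where "D = {f \<in> {n} \<rightarrow>\<^sub>E (UNIV :: (nat \<times> bool) set). f n = d}"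
  have ind: "indep_var (?P {1..<n}) ?past (?P {n}) ?now"
    by (rule indep_var_restrict[OF choices_indep]) (use n in auto)
  have sets: "E \<in> sets (?P {1..<n})" "D \<in> sets (?P {n})"
    by (auto simp: count_space_PiM_finite E_def D_def)
  \<comment> \<open>\<open>Q\<close> is constant on the fibres of \<open>?past\<close>, so pulling
    the image \<open>E\<close> back adds no points.\<close>
  have "Q \<omega>' \<longleftrightarrow> Q \<omega>" if "\<omega> \<in> space M" "\<omega>' \<in> space M" "?past \<omega> = ?past \<omega>'" for \<omega> \<omega>'
  proof -
    have "\<forall>i\<in>{1..<n}. U i \<omega> = U i \<omega>' \<and> K i \<omega> = K i \<omega>'"
      using that(3) by (metis (no_types, lifting) Pair_inject restrict_apply')
    then show ?thesis using Q that unfolding past_event_def by blast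
  qed
  then have past: "?past -` E \<inter> space M = {\<omega>\<in>space M. Q \<omega>}"
    unfolding E_def by blast
  have now: "?now -` D \<inter> space M = {\<omega>\<in>space M. ?C n \<omega> = d}"
    by (auto simp: D_def)
  have meas: "?past \<in> M \<rightarrow>\<^sub>M ?P {1..<n}" "?now \<in> M \<rightarrow>\<^sub>M ?P {n}"
    using indep_var_rv1[OF ind] indep_var_rv2[OF ind] by auto
  show "{\<omega>\<in>space M. Q \<omega>} \<in> events" "{\<omega>\<in>space M. ?C n \<omega> = d} \<in> events"
    using measurable_sets[OF meas(1) sets(1)] measurable_sets[OF meas(2) sets(2)]
    by (simp_all only: past now)
  have "(\<lambda>\<omega>. (?past \<omega>, ?now \<omega>)) -` (E \<times> D) \<inter> space M = {\<omega>\<in>space M. Q \<omega> \<and> ?C n \<omega> = d}"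
    using past now by blast
  then show "\<P>(\<omega> in M. Q \<omega> \<and> ?C n \<omega> = d) = \<P>(\<omega> in M. Q \<omega>) * \<P>(\<omega> in M. ?C n \<omega> = d)"
    using indep_varD[OF ind sets] unfolding past now by simp
qed

lemma prob_choice:
  assumes n: "n \<ge> 1" and j: "j \<in> {1..n}"
  shows "\<P>(\<omega> in M. (U n \<omega>, K n \<omega>) = (j, b)) = (if b then p else 1 - p) / n"
proof -
  have "random_variable (count_space UNIV) (\<lambda>\<omega>. (U n \<omega>, K n \<omega>))"
    using choices_indep n unfolding indep_vars_def by auto
  then have "\<P>(\<omega> in M. (U n \<omega>, K n \<omega>) = (j, b)) =
      measure (distr M (count_space UNIV) (\<lambda>\<omega>. (U n \<omega>, K n \<omega>))) {(j, b)}"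
    by (subst measure_distr) (auto intro!: arg_cong[where f = prob])
  also have "\<dots> = pmf (pair_pmf (pmf_of_set {1..n}) (bernoulli_pmf p)) (j, b)"
    unfolding choice_law[OF n] by (simp add: measure_pmf_single)
  also have "\<dots> = (if b then p else 1 - p) / n"
    using n j p_range by (simp add: pmf_pair)
  finally show ?thesis .
qed

section \<open>The law of the number of positive steps\<close>

definition num_plus :: "nat \<Rightarrow> 'a \<Rightarrow> nat" where
  "num_plus n \<omega> = card {i\<in>{1..n}. X i \<omega> = 1}"

lemma num_plus_Suc: "num_plus (Suc n) \<omega> = num_plus n \<omega> + of_bool (X (Suc n) \<omega> = 1)"
proof -
  have "{i\<in>{1..Suc n}. X i \<omega> = 1} =
      (if X (Suc n) \<omega> = 1 then insert (Suc n) {i\<in>{1..n}. X i \<omega> = 1} else {i\<in>{1..n}. X i \<omega> = 1})"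
    by (auto simp: le_Suc_eq)
  then show ?thesis by (simp add: num_plus_def)
qed

lemma walk_position_num_plus:
  assumes "\<omega> \<in> space M"
  shows "walk_position X n \<omega> = 2 * int (num_plus n \<omega>) - int n"
proof (induction n)
  case 0
  then show ?case by (simp add: walk_position_def num_plus_def)
next
  case (Suc n)
  have "walk_position X (Suc n) \<omega> = walk_position X n \<omega> + X (Suc n) \<omega>"
    by (simp add: walk_position_def)
  then show ?case using Suc X_values[OF assms, of "Suc n"] by (auto simp: num_plus_Suc)
qed

lemma past_event_num_plus:
  assumes j: "j \<in> {1..n}"
  shows "past_event n (\<lambda>\<omega>. num_plus n \<omega> = k)"
    and "past_event n (\<lambda>\<omega>. num_plus n \<omega> = k \<and> X j \<omega> = 1)"
    and "past_event n (\<lambda>\<omega>. num_plus n \<omega> = k \<and> X j \<omega> \<noteq> 1)"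
proof -
  have "num_plus n \<omega> = num_plus n \<omega>'" if "\<And>j. j \<in> {1..n} \<Longrightarrow> X j \<omega> = X j \<omega>'" for \<omega> \<omega>'
    using that unfolding num_plus_def by (intro arg_cong[where f = card]) auto
  note * = this
  show "past_event n (\<lambda>\<omega>. num_plus n \<omega> = k)"
    "past_event n (\<lambda>\<omega>. num_plus n \<omega> = k \<and> X j \<omega> = 1)"
    "past_event n (\<lambda>\<omega>. num_plus n \<omega> = k \<and> X j \<omega> \<noteq> 1)"
    by (rule past_event_X; use * j in metis)+
qed

lemma num_plus_events: "n \<ge> 1 \<Longrightarrow> {\<omega>\<in>space M. num_plus n \<omega> = k} \<in> events"
  by (rule past_event_indep(1)[OF _ past_event_num_plus(1)[of n]]) auto

text \<open>Double counting: the indicators of \<open>X j = 1\<close> add up to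
  \<open>num_plus n\<close>, which equals \<open>k\<close> on the event considered; then take
  expectations.\<close>

lemma sum_prob_num_plus:
  assumes n: "n \<ge> 1"
  shows "(\<Sum>j=1..n. \<P>(\<omega> in M. num_plus n \<omega> = k \<and> X j \<omega> = 1)) = k * \<P>(\<omega> in M. num_plus n \<omega> = k)"
proof -
  let ?A = "\<lambda>j. {\<omega>\<in>space M. num_plus n \<omega> = k \<and> X j \<omega> = 1}"
  have A: "?A j \<in> events" if "j \<in> {1..n}" for j
    using past_event_indep(1)[OF n past_event_num_plus(2)[OF that]] .
  have "(\<Sum>j=1..n. prob (?A j)) = (\<Sum>j=1..n. \<integral>\<omega>. indicator (?A j) \<omega> \<partial>M)"
    using A by (intro sum.cong) auto
  also have "\<dots> = (\<integral>\<omega>. (\<Sum>j=1..n. indicator (?A j) \<omega>) \<partial>M)"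
    using A by (subst Bochner_Integration.integral_sum) (auto simp: emeasure_eq_measure)
  also have "\<dots> = (\<integral>\<omega>. real k * indicator {\<omega>\<in>space M. num_plus n \<omega> = k} \<omega> \<partial>M)"
  proof (intro Bochner_Integration.integral_cong refl)
    fix \<omega> assume "\<omega> \<in> space M"
    then have "(\<Sum>j=1..n. indicator (?A j) \<omega> :: real) =
        (\<Sum>j=1..n. of_bool (X j \<omega> = 1)) * indicator {\<omega>\<in>space M. num_plus n \<omega> = k} \<omega>"
      unfolding sum_distrib_right by (intro sum.cong) (auto simp: indicator_def)
    also have "(\<Sum>j=1..n. of_bool (X j \<omega> = 1)) = real (num_plus n \<omega>)"
      by (simp add: num_plus_def of_bool_def sum.If_cases Int_def)
    finally show "(\<Sum>j=1..n. indicator (?A j) \<omega> :: real) =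
        real k * indicator {\<omega>\<in>space M. num_plus n \<omega> = k} \<omega>"
      by (auto simp: indicator_def)
  qed
  also have "\<dots> = k * \<P>(\<omega> in M. num_plus n \<omega> = k)"
    using num_plus_events[OF n, of k] by simp
  finally show ?thesis .
qed

text \<open>Split according to the value of the choice at time \<open>n\<close>, which is
  independent of the past. Summing over the remembered time only involves how many earlier steps are
  \<open>+1\<close>, by \<open>sum_prob_num_plus\<close>.\<close>

lemma prob_plus_step:
  assumes n: "n \<ge> 1"
  shows "real n * \<P>(\<omega> in M. num_plus n \<omega> = k \<and> X (Suc n) \<omega> = 1) =
      (k * p + (real n - k) * (1 - p)) * \<P>(\<omega> in M. num_plus n \<omega> = k)"
    and "{\<omega>\<in>space M. num_plus n \<omega> = k \<and> X (Suc n) \<omega> = 1} \<in> events"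
proof -
  let ?N = "\<P>(\<omega> in M. num_plus n \<omega> = k)"
  \<comment> \<open>\<open>?Q j b\<close> is the condition on the past under which the choice
    \<open>(j, b)\<close> yields a step \<open>+1\<close>: repeat a positive step or reverse a
    negative one.\<close>
  let ?Q = "\<lambda>j b \<omega>. num_plus n \<omega> = k \<and> (if b then X j \<omega> = 1 else X j \<omega> \<noteq> 1)"
  let ?E = "\<lambda>(j, b). {\<omega>\<in>space M. ?Q j b \<omega> \<and> (U n \<omega>, K n \<omega>) = (j, b)}"
  let ?I = "{1..n} \<times> (UNIV :: bool set)"
  have past: "past_event n (?Q j b)" if "j \<in> {1..n}" for j b
    using past_event_num_plus(2,3)[OF that] by (cases b) auto
  have E: "?E jb \<in> events" if "jb \<in> ?I" for jb
  proof -
    obtain j b where jb: "jb = (j, b)" "j \<in> {1..n}" using \<open>jb \<in> ?I\<close> by blast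
    have "{\<omega>\<in>space M. ?Q j b \<omega>} \<inter> {\<omega>\<in>space M. (U n \<omega>, K n \<omega>) = (j, b)} \<in> events"
      using past_event_indep(1,2)[OF n past[OF jb(2)]] by blast
    also have "{\<omega>\<in>space M. ?Q j b \<omega>} \<inter> {\<omega>\<in>space M. (U n \<omega>, K n \<omega>) = (j, b)} = ?E jb"
      using jb by auto
    finally show ?thesis .
  qed
  have event: "{\<omega>\<in>space M. num_plus n \<omega> = k \<and> X (Suc n) \<omega> = 1} = (\<Union>jb\<in>?I. ?E jb)" (is "?S = _")
  proof (intro set_eqI)
    fix \<omega>
    show "\<omega> \<in> ?S \<longleftrightarrow> \<omega> \<in> (\<Union>jb\<in>?I. ?E jb)"
    proof (cases "\<omega> \<in> space M")
      case True
      then have U: "U n \<omega> \<in> {1..n}" using U_range n by blast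
      then have "X (Suc n) \<omega> = 1 \<longleftrightarrow> (if K n \<omega> then X (U n \<omega>) \<omega> = 1 else X (U n \<omega>) \<omega> \<noteq> 1)"
        using next_step[OF n True] X_values[OF True, of "U n \<omega>"] by auto
      then show ?thesis using True U by auto
    qed auto
  qed
  \<comment> \<open>The event depends on the choice at time \<open>n\<close>, so it is not covered
    by \<open>past_event\<close> at \<open>n\<close>; its measurability comes from the finite
    decomposition.\<close>
  show "?S \<in> events"
    unfolding event by (rule sets.finite_UN) (simp, rule E)
  have "prob ?S = (\<Sum>jb\<in>?I. prob (?E jb))"
    unfolding event
    by (rule finite_measure_finite_Union)
      (simp, rule image_subsetI, erule E, auto simp: disjoint_family_on_def)
  also have "\<dots> = (\<Sum>j=1..n. \<Sum>b\<in>UNIV. \<P>(\<omega> in M. ?Q j b \<omega>) * ((if b then p else 1 - p) / n))"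
    unfolding sum.cartesian_product
  proof (rule sum.cong[OF refl])
    fix jb assume "jb \<in> ?I"
    then obtain j b where jb: "jb = (j, b)" "j \<in> {1..n}" by blast
    show "prob (?E jb) = (case jb of (j, b) \<Rightarrow> \<P>(\<omega> in M. ?Q j b \<omega>) * ((if b then p else 1 - p) / n))"
      using past_event_indep(3)[OF n past[OF jb(2)], of b "(j, b)"] prob_choice[OF n jb(2), of b]
      unfolding jb(1) by (simp only: prod.case)
  qed
  also have "\<dots> = (\<Sum>j=1..n. \<P>(\<omega> in M. num_plus n \<omega> = k \<and> X j \<omega> = 1) * (p / n) +
      (?N - \<P>(\<omega> in M. num_plus n \<omega> = k \<and> X j \<omega> = 1)) * ((1 - p) / n))"
  proof (intro sum.cong refl)
    fix j assume j: "j \<in> {1..n}"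
    have "{\<omega>\<in>space M. num_plus n \<omega> = k \<and> X j \<omega> \<noteq> 1} =
        {\<omega>\<in>space M. num_plus n \<omega> = k} - {\<omega>\<in>space M. num_plus n \<omega> = k \<and> X j \<omega> = 1}" by auto
    then have "\<P>(\<omega> in M. num_plus n \<omega> = k \<and> X j \<omega> \<noteq> 1) =
        ?N - \<P>(\<omega> in M. num_plus n \<omega> = k \<and> X j \<omega> = 1)"
      using num_plus_events[OF n] past_event_indep(1)[OF n past_event_num_plus(2)[OF j]]
      by (simp only:) (rule finite_measure_Diff, auto)
    then show "(\<Sum>b\<in>UNIV. \<P>(\<omega> in M. ?Q j b \<omega>) * ((if b then p else 1 - p) / n)) =
        \<P>(\<omega> in M. num_plus n \<omega> = k \<and> X j \<omega> = 1) * (p / n) +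
        (?N - \<P>(\<omega> in M. num_plus n \<omega> = k \<and> X j \<omega> = 1)) * ((1 - p) / n)"
      by (simp add: UNIV_bool)
  qed
  also have "\<dots> = k * ?N * (p / n) + (n * ?N - k * ?N) * ((1 - p) / n)"
    unfolding sum_prob_num_plus[OF n, symmetric]
    by (simp add: sum.distrib sum_subtractf sum_distrib_right[symmetric]
        del: times_divide_eq_right)
  finally show "real n * prob ?S = (k * p + (real n - k) * (1 - p)) * ?N"
    using n by (simp add: field_simps)
qed

text \<open>To reach \<open>Suc k\<close> positive steps, either \<open>Suc k\<close> were there and
  the new step is not \<open>+1\<close>, or \<open>k\<close> were there and it is.\<close>

lemma prob_num_plus_Suc:
  fixes a :: real
  assumes n: "n \<ge> 1" and a: "a = 2 * p - 1"
  shows "2 * real n * \<P>(\<omega> in M. num_plus (Suc n) \<omega> = Suc k) =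
      (n * (1 + a) - 2 * a * Suc k) * \<P>(\<omega> in M. num_plus n \<omega> = Suc k) +
      (n * (1 - a) + 2 * a * k) * \<P>(\<omega> in M. num_plus n \<omega> = k)"
proof -
  let ?N = "\<lambda>k. {\<omega>\<in>space M. num_plus n \<omega> = k}"
  let ?P = "\<lambda>k. {\<omega>\<in>space M. num_plus n \<omega> = k \<and> X (Suc n) \<omega> = 1}"
  have "{\<omega>\<in>space M. num_plus (Suc n) \<omega> = Suc k} = (?N (Suc k) - ?P (Suc k)) \<union> ?P k"
    by (auto simp: num_plus_Suc split: if_splits)
  then have "\<P>(\<omega> in M. num_plus (Suc n) \<omega> = Suc k) = prob ((?N (Suc k) - ?P (Suc k)) \<union> ?P k)"
    by simp
  also have "\<dots> = prob (?N (Suc k) - ?P (Suc k)) + prob (?P k)"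
    using num_plus_events[OF n] prob_plus_step(2)[OF n]
    by (intro finite_measure_Union) auto
  also have "prob (?N (Suc k) - ?P (Suc k)) = prob (?N (Suc k)) - prob (?P (Suc k))"
    using num_plus_events[OF n] prob_plus_step(2)[OF n]
    by (intro finite_measure_Diff) auto
  finally have eq: "\<P>(\<omega> in M. num_plus (Suc n) \<omega> = Suc k) =
      prob (?N (Suc k)) - prob (?P (Suc k)) + prob (?P k)" .
  have "2 * real n * \<P>(\<omega> in M. num_plus (Suc n) \<omega> = Suc k) =
      2 * (n * prob (?N (Suc k))) - 2 * (n * prob (?P (Suc k))) + 2 * (n * prob (?P k))"
    unfolding eq by (simp only: algebra_simps)
  then show ?thesis
    unfolding prob_plus_step(1)[OF n] a by (simp add: algebra_simps)
qed

lemma num_plus_ge_one: "\<omega> \<in> space M \<Longrightarrow> n \<ge> 1 \<Longrightarrow> num_plus n \<omega> \<ge> 1"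
  using first_step[of \<omega>] card_mono[of "{i\<in>{1..n}. X i \<omega> = 1}" "{1}"]
  by (simp add: num_plus_def)

lemma erw_array_num_plus:
  assumes a: "a = 2 * p - 1" and "p < 1"
  shows "erw_array a (\<lambda>n k. \<P>(\<omega> in M. num_plus n \<omega> = k))"
proof
  show "-1 \<le> a" "a < 1" using assms p_range by auto
  have "num_plus 1 \<omega> = 1" if "\<omega> \<in> space M" for \<omega>
    using num_plus_Suc[of 0 \<omega>] first_step[OF that] by (simp add: num_plus_def)
  then have "{\<omega>\<in>space M. num_plus 1 \<omega> = k} = (if k = 1 then space M else {})" for k by auto
  then show "\<P>(\<omega> in M. num_plus 1 \<omega> = k) = of_bool (k = 1)" for k by (simp add: prob_space)
  have "{\<omega>\<in>space M. num_plus n \<omega> = 0} = {}" if "n \<ge> 1" for n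
    using num_plus_ge_one[OF _ that] by force
  then show "\<P>(\<omega> in M. num_plus n \<omega> = 0) = 0" if "n \<ge> 1" for n
    using that by (simp only: measure_empty)
qed (rule prob_num_plus_Suc[OF _ a])

end

section \<open>The threshold and the transfer to the walk\<close>

theorem proposition2p2:
  fixes M :: "'a measure"
    and p a :: real
    and U :: "nat \<Rightarrow> 'a \<Rightarrow> nat"
    and K :: "nat \<Rightarrow> 'a \<Rightarrow> bool"
    and X :: "nat \<Rightarrow> 'a \<Rightarrow> int"
  assumes "p \<in> {0..<1}"
    and "a = 2 * p - 1"
    and "elephant_random_walk M p U K X"
  shows "\<exists>a\<^sub>0::real.
     (\<forall>x. (x > 0 \<and> x ^ 3 + 4 * x ^ 2 + 2 * x = 3) \<longleftrightarrow> x = a\<^sub>0) \<and>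
     0.61803 \<le> a\<^sub>0 \<and> a\<^sub>0 < 0.61804 \<and>
     ((\<forall>n\<ge>1. log_concave_seq n
          (\<lambda>k. \<P>(\<omega> in M. walk_position X n \<omega> = 2 * int k - int n)))
       \<longleftrightarrow> a \<in> {-1..a\<^sub>0})"
proof -
  interpret elephant_random_walk M p U K X by fact
  interpret erw_array a "\<lambda>n k. \<P>(\<omega> in M. num_plus n \<omega> = k)"
    using assms by (intro erw_array_num_plus) auto
  \<comment> \<open>The positive root of \<open>x^2 + x = 1\<close>; the other root is
    \<open>-1 - a\<^sub>0\<close>.\<close>
  define a\<^sub>0 :: real where "a\<^sub>0 = (sqrt 5 - 1) / 2"
  have bounds: "0.61803 \<le> a\<^sub>0" "a\<^sub>0 < 0.61804"
    unfolding a\<^sub>0_def using real_le_rsqrt[of "2.23606" 5] real_less_lsqrt[of "2.23608" 5]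
    by (auto simp: power2_eq_square)
  have factor: "1 - (x\<^sup>2 + x) = (a\<^sub>0 - x) * (x + 1 + a\<^sub>0)" for x
    by (simp add: a\<^sub>0_def field_simps power2_eq_square)
  have root: "(x > 0 \<and> x ^ 3 + 4 * x ^ 2 + 2 * x = 3) \<longleftrightarrow> x = a\<^sub>0" for x
  proof -
    \<comment> \<open>The cubic has the further root \<open>-3\<close>, so \<open>a\<^sub>0\<close>
      is its only positive root.\<close>
    have "x ^ 3 + 4 * x ^ 2 + 2 * x - 3 = - (x + 3) * (1 - (x\<^sup>2 + x))"
      by (simp add: algebra_simps power2_eq_square power3_eq_cube)
    then have "x ^ 3 + 4 * x ^ 2 + 2 * x = 3 \<longleftrightarrow> (x + 3) * ((a\<^sub>0 - x) * (x + 1 + a\<^sub>0)) = 0"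
      unfolding factor by (metis eq_iff_diff_eq_0 mult_minus_left neg_equal_0_iff_equal)
    then show ?thesis using bounds by auto
  qed
  have "{\<omega>\<in>space M. walk_position X n \<omega> = 2 * int k - int n} = {\<omega>\<in>space M. num_plus n \<omega> = k}"
    for n k using walk_position_num_plus by auto
  then have "(\<forall>n\<ge>1. log_concave_seq n
      (\<lambda>k. \<P>(\<omega> in M. walk_position X n \<omega> = 2 * int k - int n))) \<longleftrightarrow> a\<^sup>2 + a \<le> 1"
    using log_concave_all_iff by simp
  also have "\<dots> \<longleftrightarrow> 0 \<le> (a\<^sub>0 - a) * (a + 1 + a\<^sub>0)" unfolding factor[symmetric] by simp
  \<comment> \<open>Since \<open>a \<ge> -1\<close>, the factor \<open>a + 1 + a\<^sub>0\<close> is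
    positive and the sign is that of \<open>a\<^sub>0 - a\<close>.\<close>
  also have "\<dots> \<longleftrightarrow> a \<in> {-1..a\<^sub>0}" using a_range bounds by (auto simp: zero_le_mult_iff)
  finally show ?thesis using root bounds by (intro exI[of _ a\<^sub>0]) simp
qed

end
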